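(* Working in ZFC as metatheory and assuming ZFC is consistent, for all integers $n,m\geq1$ the formula $WO^1$ is HPL-independent of $choice_h^{n,m}$: there is a Henkin structure of second order that is a model of $choice_h^{n,m}\cup\{WO^1\}$, and there is a Henkin structure of second order that is a model of $choice_h^{n,m}\cup\{\neg WO^1\}$.
   Context: Second-order language: many-sorted first-order language with identity, individual variables (sort $0$), predicate variables of each sort $n\ge1$, atomic formulas $x_i=x_j$, $A=B$ (same sort), $Ax_1\cdots x_n$; closed under connectives and quantifiers over both kinds. A predicate structure $(J_n)_{n\ge0}$: nonempty individual domain $J_0$ and for each $n\ge1$ a nonempty set $J_n$ of $n$-ary predicates (functions $J_0^n\to\{true,false\}$); sort-$n$ variables range over $J_n$, $Ax_1\cdots x_n$ true iff the assigned predicate is true at the assigned tuple, $=$ is real equality. A Henkin structure is a predicate structure satisfying all comprehension axioms $\exists A\forall x_1\cdots\forall x_n(Ax_1\cdots x_n\leftrightarrow H)$ ($A$ not occurring in $H$). $choice_h^{n,m}$ is the set of all formulas $choice_h^{n,m}(H)=\forall\mathbf{x}\exists D\,H(\mathbf{x},D)\to\exists S\forall\mathbf{x}\exists D(\forall\mathbf{y}(D\mathbf{y}\leftrightarrow S\mathbf{x}\mathbf{y})\wedge H(\mathbf{x},D))$, with $\mathbf{x}=x_1,\ldots,x_n$, $\mathbf{y}=y_1,\ldots,y_m$, $D$ of sort $m$, $S$ of sort $n+m$, and $H$ any formula in which at most $x_1,\ldots,x_n,D$ occur free (and only free). $WO^1$ is the second-order well-ordering principle for unary predicates: for every unary $A$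 there is a binary $T$ linearly ordering $A$ such that every unary $B$ with $\exists xBx$ and $\forall x(Bx\to Ax)$ has a $T$-least element. A formula is HPL-independent of a set of formulas $\Gamma$ if neither it nor its negation holds in all Henkin structures that are models of $\Gamma$. *)

theory Defs
  imports Main
begin

section \<open>The second-order language\<close>

type_synonym ivar = nat

text \<open>A predicate variable is a pair of its sort (arity) and its index.\<close>
type_synonym pvar = "nat \<times> nat"

datatype form =
    EqI ivar ivar
  | EqP pvar pvar
  | App pvar "ivar list"
  | Neg form
  | Conj form form
  | Disj form form
  | Imp form form
  | Iff form form
  | AllI ivar form
  | ExI ivar form
  | AllP pvar form
  | ExP pvar form

text \<open>Only terms satisfying the following predicate are formulas: predicate variables have
  sort at least 1, are applied to as many individual variables as their sort demands, and
  are equated only with predicate variables of the same sort.\<close>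
primrec wff :: "form \<Rightarrow> bool" where
  "wff (EqI x y) \<longleftrightarrow> True"
| "wff (EqP A B) \<longleftrightarrow> fst A \<ge> 1 \<and> fst A = fst B"
| "wff (App A xs) \<longleftrightarrow> fst A \<ge> 1 \<and> length xs = fst A"
| "wff (Neg F) \<longleftrightarrow> wff F"
| "wff (Conj F G) \<longleftrightarrow> wff F \<and> wff G"
| "wff (Disj F G) \<longleftrightarrow> wff F \<and> wff G"
| "wff (Imp F G) \<longleftrightarrow> wff F \<and> wff G"
| "wff (Iff F G) \<longleftrightarrow> wff F \<and> wff G"
| "wff (AllI x F) \<longleftrightarrow> wff F"
| "wff (ExI x F) \<longleftrightarrow> wff F"
| "wff (AllP A F) \<longleftrightarrow> fst A \<ge> 1 \<and> wff F"
| "wff (ExP A F) \<longleftrightarrow> fst A \<ge> 1 \<and> wff F"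

primrec free_ivars :: "form \<Rightarrow> ivar set" where
  "free_ivars (EqI x y) = {x, y}"
| "free_ivars (EqP A B) = {}"
| "free_ivars (App A xs) = set xs"
| "free_ivars (Neg F) = free_ivars F"
| "free_ivars (Conj F G) = free_ivars F \<union> free_ivars G"
| "free_ivars (Disj F G) = free_ivars F \<union> free_ivars G"
| "free_ivars (Imp F G) = free_ivars F \<union> free_ivars G"
| "free_ivars (Iff F G) = free_ivars F \<union> free_ivars G"
| "free_ivars (AllI x F) = free_ivars F - {x}"
| "free_ivars (ExI x F) = free_ivars F - {x}"
| "free_ivars (AllP A F) = free_ivars F"
| "free_ivars (ExP A F) = free_ivars F"

primrec free_pvars :: "form \<Rightarrow> pvar set" where
  "free_pvars (EqI x y) = {}"
| "free_pvars (EqP A B) = {A, B}"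
| "free_pvars (App A xs) = {A}"
| "free_pvars (Neg F) = free_pvars F"
| "free_pvars (Conj F G) = free_pvars F \<union> free_pvars G"
| "free_pvars (Disj F G) = free_pvars F \<union> free_pvars G"
| "free_pvars (Imp F G) = free_pvars F \<union> free_pvars G"
| "free_pvars (Iff F G) = free_pvars F \<union> free_pvars G"
| "free_pvars (AllI x F) = free_pvars F"
| "free_pvars (ExI x F) = free_pvars F"
| "free_pvars (AllP A F) = free_pvars F - {A}"
| "free_pvars (ExP A F) = free_pvars F - {A}"

text \<open>The variables quantified somewhere in a formula.\<close>
primrec bound_ivars :: "form \<Rightarrow> ivar set" where
  "bound_ivars (EqI x y) = {}"
| "bound_ivars (EqP A B) = {}"
| "bound_ivars (App A xs) = {}"
| "bound_ivars (Neg F) = bound_ivars F"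
| "bound_ivars (Conj F G) = bound_ivars F \<union> bound_ivars G"
| "bound_ivars (Disj F G) = bound_ivars F \<union> bound_ivars G"
| "bound_ivars (Imp F G) = bound_ivars F \<union> bound_ivars G"
| "bound_ivars (Iff F G) = bound_ivars F \<union> bound_ivars G"
| "bound_ivars (AllI x F) = insert x (bound_ivars F)"
| "bound_ivars (ExI x F) = insert x (bound_ivars F)"
| "bound_ivars (AllP A F) = bound_ivars F"
| "bound_ivars (ExP A F) = bound_ivars F"

primrec bound_pvars :: "form \<Rightarrow> pvar set" where
  "bound_pvars (EqI x y) = {}"
| "bound_pvars (EqP A B) = {}"
| "bound_pvars (App A xs) = {}"
| "bound_pvars (Neg F) = bound_pvars F"
| "bound_pvars (Conj F G) = bound_pvars F \<union> bound_pvars G"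
| "bound_pvars (Disj F G) = bound_pvars F \<union> bound_pvars G"
| "bound_pvars (Imp F G) = bound_pvars F \<union> bound_pvars G"
| "bound_pvars (Iff F G) = bound_pvars F \<union> bound_pvars G"
| "bound_pvars (AllI x F) = bound_pvars F"
| "bound_pvars (ExI x F) = bound_pvars F"
| "bound_pvars (AllP A F) = insert A (bound_pvars F)"
| "bound_pvars (ExP A F) = insert A (bound_pvars F)"

definition AllIs :: "ivar list \<Rightarrow> form \<Rightarrow> form" where
  "AllIs xs F = foldr AllI xs F"


section \<open>Predicate structures and truth\<close>

text \<open>The component \<open>J\<^sub>0\<close> is \<open>indiv M\<close> and, for \<open>n \<ge> 1\<close>, \<open>J\<^sub>n\<close> is \<open>preds M n\<close>; the value
  \<open>preds M 0\<close> is irrelevant. Tuples are lists. So that HOL equality is equality of predicates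
  on \<open>J\<^sub>0\<close>, an \<open>n\<close>-ary predicate is required to be false off the set of \<open>n\<close>-tuples over \<open>J\<^sub>0\<close>.\<close>
record 'i pstruct =
  indiv :: "'i set"
  preds :: "nat \<Rightarrow> ('i list \<Rightarrow> bool) set"

definition tuples :: "'i set \<Rightarrow> nat \<Rightarrow> 'i list set" where
  "tuples X n = {as. length as = n \<and> set as \<subseteq> X}"

definition predicate_structure :: "'i pstruct \<Rightarrow> bool" where
  "predicate_structure M \<longleftrightarrow>
     indiv M \<noteq> {} \<and>
     (\<forall>n\<ge>1. preds M n \<noteq> {} \<and>
        (\<forall>P\<in>preds M n. \<forall>as. P as \<longrightarrow> as \<in> tuples (indiv M) n))"

definition assignment ::
    "'i pstruct \<Rightarrow> (ivar \<Rightarrow> 'i) \<Rightarrow> (pvar \<Rightarrow> 'i list \<Rightarrow> bool) \<Rightarrow> bool" where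
  "assignment M v V \<longleftrightarrow>
     (\<forall>x. v x \<in> indiv M) \<and> (\<forall>A. fst A \<ge> 1 \<longrightarrow> V A \<in> preds M (fst A))"

primrec sat ::
    "'i pstruct \<Rightarrow> (ivar \<Rightarrow> 'i) \<Rightarrow> (pvar \<Rightarrow> 'i list \<Rightarrow> bool) \<Rightarrow> form \<Rightarrow> bool" where
  "sat M v V (EqI x y) \<longleftrightarrow> v x = v y"
| "sat M v V (EqP A B) \<longleftrightarrow> V A = V B"
| "sat M v V (App A xs) \<longleftrightarrow> V A (map v xs)"
| "sat M v V (Neg F) \<longleftrightarrow> \<not> sat M v V F"
| "sat M v V (Conj F G) \<longleftrightarrow> sat M v V F \<and> sat M v V G"
| "sat M v V (Disj F G) \<longleftrightarrow> sat M v V F \<or> sat M v V G"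
| "sat M v V (Imp F G) \<longleftrightarrow> (sat M v V F \<longrightarrow> sat M v V G)"
| "sat M v V (Iff F G) \<longleftrightarrow> (sat M v V F \<longleftrightarrow> sat M v V G)"
| "sat M v V (AllI x F) \<longleftrightarrow> (\<forall>a\<in>indiv M. sat M (v(x := a)) V F)"
| "sat M v V (ExI x F) \<longleftrightarrow> (\<exists>a\<in>indiv M. sat M (v(x := a)) V F)"
| "sat M v V (AllP A F) \<longleftrightarrow> (\<forall>P\<in>preds M (fst A). sat M v (V(A := P)) F)"
| "sat M v V (ExP A F) \<longleftrightarrow> (\<exists>P\<in>preds M (fst A). sat M v (V(A := P)) F)"

text \<open>A formula holds in a structure iff it is true under all assignments; free variables are
  thus read as universally quantified parameters.\<close>
definition holds :: "'i pstruct \<Rightarrow> form \<Rightarrow> bool" where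
  "holds M F \<longleftrightarrow> (\<forall>v V. assignment M v V \<longrightarrow> sat M v V F)"

definition is_model :: "'i pstruct \<Rightarrow> form set \<Rightarrow> bool" where
  "is_model M \<Gamma> \<longleftrightarrow> (\<forall>F\<in>\<Gamma>. holds M F)"


section \<open>Henkin structures\<close>

definition comprehension :: "form set" where
  "comprehension =
     {ExP A (AllIs xs (Iff (App A xs) H)) | A xs H.
        fst A \<ge> 1 \<and> length xs = fst A \<and> distinct xs \<and> wff H \<and>
        A \<notin> free_pvars H \<union> bound_pvars H}"

definition henkin_structure :: "'i pstruct \<Rightarrow> bool" where
  "henkin_structure M \<longleftrightarrow> predicate_structure M \<and> is_model M comprehension"

text \<open>HOL cannot quantify over types inside a formula, so the type from whose subsets the
  individual domains are taken is a parameter. The language being countable, the downward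
  Loewenheim-Skolem theorem shows that any infinite type gives the same notion.\<close>
definition HPL_independent :: "'i itself \<Rightarrow> form set \<Rightarrow> form \<Rightarrow> bool" where
  "HPL_independent TYPE('i) \<Gamma> F \<longleftrightarrow>
     \<not> (\<forall>M :: 'i pstruct. henkin_structure M \<and> is_model M \<Gamma> \<longrightarrow> holds M F) \<and>
     \<not> (\<forall>M :: 'i pstruct. henkin_structure M \<and> is_model M \<Gamma> \<longrightarrow> holds M (Neg F))"


section \<open>Choice and well-ordering\<close>

definition choice_form :: "ivar list \<Rightarrow> ivar list \<Rightarrow> pvar \<Rightarrow> pvar \<Rightarrow> form \<Rightarrow> form" where
  "choice_form xs ys D S H =
     Imp (AllIs xs (ExP D H))
         (ExP S (AllIs xs (ExP D
            (Conj (AllIs ys (Iff (App D ys) (App S (xs @ ys)))) H))))"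

text \<open>Parameters are not admitted in \<open>H\<close>: at most \<open>xs\<close> and \<open>D\<close> occur free, and none of
  these is quantified in \<open>H\<close>.\<close>
definition choice_h :: "nat \<Rightarrow> nat \<Rightarrow> form set" where
  "choice_h n m =
     {choice_form xs ys D S H | xs ys D S H.
        length xs = n \<and> length ys = m \<and> distinct (xs @ ys) \<and>
        fst D = m \<and> fst S = n + m \<and> wff H \<and>
        free_ivars H \<subseteq> set xs \<and> free_pvars H \<subseteq> {D} \<and>
        bound_ivars H \<inter> set xs = {} \<and> D \<notin> bound_pvars H}"

text \<open>\<open>T\<close> is a reflexive linear order on \<open>A\<close>; nothing is required of \<open>T\<close> outside \<open>A\<close>. The
  individual variables 0, 1, 2 play the roles of \<open>x\<close>, \<open>y\<close>, \<open>z\<close>.\<close>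
definition lin_ord :: "pvar \<Rightarrow> pvar \<Rightarrow> form" where
  "lin_ord A T =
     Conj (AllI 0 (Imp (App A [0]) (App T [0, 0])))
    (Conj (AllI 0 (AllI 1 (Imp (Conj (App A [0]) (App A [1]))
             (Imp (Conj (App T [0, 1]) (App T [1, 0])) (EqI 0 1)))))
    (Conj (AllI 0 (AllI 1 (AllI 2 (Imp (Conj (App A [0]) (Conj (App A [1]) (App A [2])))
             (Imp (Conj (App T [0, 1]) (App T [1, 2])) (App T [0, 2]))))))
          (AllI 0 (AllI 1 (Imp (Conj (App A [0]) (App A [1]))
             (Disj (App T [0, 1]) (App T [1, 0])))))))"

definition WO1 :: form where
  "WO1 =
    (let A = (1, 0); B = (1, 1); T = (2, 0) in
     AllP A (ExP T (Conj (lin_ord A T)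
       (AllP B (Imp (Conj (ExI 0 (App B [0])) (AllI 0 (Imp (App B [0]) (App A [0]))))
          (ExI 0 (Conj (App B [0]) (AllI 1 (Imp (App B [1]) (App T [0, 1]))))))))))"

end

theory Submission
  imports Defs
begin

text \<open>The full structure over a single individual satisfies everything required with \<open>WO1\<close>. For the
  negation take Fraenkel's basic permutation model: all individuals of the given infinite type,
  and as predicates those fixed by every permutation that fixes some finite set pointwise. No such
  binary predicate orders two individuals outside its finite support, so \<open>WO1\<close> fails.
  For choice, truth of \<open>H\<close> is invariant under permutations since \<open>H\<close> has no parameters. There are
  finitely many orbits of \<open>n\<close>-tuples; choose in each a representative \<open>c\<close> and a witness for it, all
  witnesses being supported by one finite set \<open>E\<close>. Given a tuple \<open>as\<close>, move \<open>c\<close> to \<open>as\<close> and \<open>E\<close> into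
  \<open>as\<close> together with a fixed, sufficiently large finite set \<open>P\<close>, by a permutation whose values in
  \<open>P\<close> depend only on \<open>P - set as\<close> and \<open>c\<close>. The transported witnesses form a relation supported
  by \<open>P\<close>.\<close>

section \<open>Semantics\<close>

text \<open>The head variable is updated first, matching the outermost quantifier of
  \<open>AllIs\<close>, so truth of a quantifier block unfolds along this recursion.\<close>

primrec upds :: "(ivar \<Rightarrow> 'i) \<Rightarrow> ivar list \<Rightarrow> 'i list \<Rightarrow> ivar \<Rightarrow> 'i" where
  "upds v [] as = v"
| "upds v (x # xs) as = upds (v(x := hd as)) xs (tl as)"

lemma upds_notin: "x \<notin> set xs \<Longrightarrow> upds v xs as x = v x"
  by (induction xs arbitrary: v as) auto

lemma map_upds: "distinct xs \<Longrightarrow> length as = length xs \<Longrightarrow> map (upds v xs as) xs = as"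
proof (induction xs arbitrary: v as)
  case (Cons x xs)
  then show ?case by (cases as) (auto simp: upds_notin)
qed simp

lemma upds_eq:
  assumes "x \<in> set xs" "distinct xs" "length as = length xs"
  shows "upds v xs as x = upds w xs as x"
  using map_upds[OF assms(2,3), of v] map_upds[OF assms(2,3), of w] assms(1)
  by (metis map_eq_conv)

lemma comp_upds:
  "length as = length xs \<Longrightarrow> p \<circ> upds v xs as = upds (p \<circ> v) xs (map p as)"
proof (induction xs arbitrary: v as)
  case (Cons x xs)
  from Cons.prems obtain a as' where as: "as = a # as'" "length as' = length xs"
    by (cases as) auto
  have "p \<circ> v(x := a) = (p \<circ> v)(x := p a)" by auto
  then show ?case using Cons.IH[OF as(2), of "v(x := a)"]
    by (simp only: as upds.simps list.sel list.map)
qed simp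

lemma upds_cong: "v x = w x \<Longrightarrow> upds v xs as x = upds w xs as x"
proof (induction xs arbitrary: v w as)
  case (Cons y xs)
  from Cons.prems have "(v(y := hd as)) x = (w(y := hd as)) x" by simp
  then show ?case unfolding upds.simps by (rule Cons.IH)
qed simp

lemma sat_AllIs:
  "sat M v V (AllIs xs F) \<longleftrightarrow> (\<forall>as\<in>tuples (indiv M) (length xs). sat M (upds v xs as) V F)"
proof (induction xs arbitrary: v)
  case Nil
  then show ?case by (simp add: AllIs_def tuples_def)
next
  case (Cons x xs)
  have *: "tuples X (Suc k) = (\<lambda>(a, as). a # as) ` (X \<times> tuples X k)" for X :: "'a set" and k
    by (force simp: tuples_def length_Suc_conv)
  have "sat M v V (AllIs (x # xs) F) \<longleftrightarrow> (\<forall>a\<in>indiv M. sat M (v(x := a)) V (AllIs xs F))"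
    by (simp add: AllIs_def)
  also have "\<dots> \<longleftrightarrow> (\<forall>a\<in>indiv M. \<forall>as\<in>tuples (indiv M) (length xs).
      sat M (upds v (x # xs) (a # as)) V F)"
    by (simp only: Cons.IH upds.simps list.sel)
  also have "\<dots> \<longleftrightarrow> (\<forall>as\<in>tuples (indiv M) (length (x # xs)). sat M (upds v (x # xs) as) V F)"
    by (auto simp: * simp del: upds.simps)
  finally show ?case .
qed

lemma sat_cong:
  "\<forall>x\<in>free_ivars F. v x = w x \<Longrightarrow> \<forall>A\<in>free_pvars F. V A = W A \<Longrightarrow> sat M v V F = sat M w W F"
proof (induction F arbitrary: v w V W)
  case (App A xs)
  then have "map v xs = map w xs" by simp
  with App show ?case by (simp del: map_eq_conv)
next
  case (AllI x F)
  have "sat M (v(x := a)) V F = sat M (w(x := a)) W F" for a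
    by (rule AllI.IH) (use AllI.prems in auto)
  then show ?case by simp
next
  case (ExI x F)
  have "sat M (v(x := a)) V F = sat M (w(x := a)) W F" for a
    by (rule ExI.IH) (use ExI.prems in auto)
  then show ?case by simp
next
  case (AllP A F)
  have "sat M v (V(A := P)) F = sat M w (W(A := P)) F" for P
    by (rule AllP.IH) (use AllP.prems in auto)
  then show ?case by simp
next
  case (ExP A F)
  have "sat M v (V(A := P)) F = sat M w (W(A := P)) F" for P
    by (rule ExP.IH) (use ExP.prems in auto)
  then show ?case by simp
next
  case (Neg F)
  have "sat M v V F = sat M w W F" by (rule Neg.IH) (use Neg.prems in auto)
  then show ?case by simp
next
  case (Conj F G)
  have "sat M v V F = sat M w W F" "sat M v V G = sat M w W G"
    by (rule Conj.IH; use Conj.prems in auto)+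
  then show ?case by simp
next
  case (Disj F G)
  have "sat M v V F = sat M w W F" "sat M v V G = sat M w W G"
    by (rule Disj.IH; use Disj.prems in auto)+
  then show ?case by simp
next
  case (Imp F G)
  have "sat M v V F = sat M w W F" "sat M v V G = sat M w W G"
    by (rule Imp.IH; use Imp.prems in auto)+
  then show ?case by simp
next
  case (Iff F G)
  have "sat M v V F = sat M w W F" "sat M v V G = sat M w W G"
    by (rule Iff.IH; use Iff.prems in auto)+
  then show ?case by simp
qed simp_all

lemma finite_free_ivars: "finite (free_ivars F)"
  by (induction F) auto

lemma finite_free_pvars: "finite (free_pvars F)"
  by (induction F) auto

text \<open>An \<open>assignment\<close> constrains only predicate variables of sort at least 1.
  Through this fact every free predicate variable of a formula denotes a predicate of the structure,
  hence one with finite support in Fraenkel's model.\<close>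

lemma wff_free_pvars: "wff F \<Longrightarrow> A \<in> free_pvars F \<Longrightarrow> fst A \<ge> 1"
  by (induction F) auto

section \<open>Semantic criteria for comprehension and choice\<close>

text \<open>Comprehension is closure under definability with parameters. Since \<open>A\<close> is
  not free in \<open>H\<close>, interpreting \<open>A\<close> by the defined predicate leaves the
  truth of \<open>H\<close> unchanged.\<close>

lemma henkin_structureI:
  assumes "predicate_structure M"
    and "\<And>v V xs H. assignment M v V \<Longrightarrow> xs \<noteq> [] \<Longrightarrow> wff H \<Longrightarrow>
      (\<lambda>as. as \<in> tuples (indiv M) (length xs) \<and> sat M (upds v xs as) V H) \<in> preds M (length xs)"
  shows "henkin_structure M"
proof -
  have "sat M v V (ExP A (AllIs xs (Iff (App A xs) H)))"
    if VV: "assignment M v V" and A: "fst A \<ge> 1" "length xs = fst A" and "distinct xs" "wff H"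
      and nf: "A \<notin> free_pvars H" for v V A xs H
  proof -
    let ?Q = "\<lambda>as. as \<in> tuples (indiv M) (length xs) \<and> sat M (upds v xs as) V H"
    have "xs \<noteq> []" using A by auto
    then have "?Q \<in> preds M (fst A)" using assms(2)[OF VV _ \<open>wff H\<close>] by (simp only: A(2)[symmetric])
    moreover have "sat M w (V(A := ?Q)) H = sat M w V H" for w
      by (rule sat_cong) (use nf in auto)
    ultimately show ?thesis using \<open>distinct xs\<close>
      by (auto simp: sat_AllIs map_upds tuples_def intro!: bexI[of _ ?Q])
  qed
  then show ?thesis using assms(1)
    by (auto simp: henkin_structure_def is_model_def comprehension_def holds_def)
qed

text \<open>The second premise on \<open>h\<close> holds for every assignment because \<open>H\<close> has no parameters; it is what
  makes \<open>h\<close> invariant under automorphisms.\<close>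
lemma choice_modelI:
  assumes "n \<ge> 1" and "m \<ge> 1"
    and choice: "\<And>h. \<lbrakk>\<And>as. as \<in> tuples (indiv M) n \<Longrightarrow> \<exists>D\<in>preds M m. h as D;
      \<exists>xs D H. length xs = n \<and> distinct xs \<and> free_ivars H \<subseteq> set xs \<and> free_pvars H \<subseteq> {D} \<and>
        (\<forall>v V as P. as \<in> tuples (indiv M) n \<longrightarrow> h as P = sat M (upds v xs as) (V(D := P)) H)\<rbrakk> \<Longrightarrow>
      \<exists>S\<in>preds M (n + m). \<forall>as\<in>tuples (indiv M) n. \<exists>D\<in>preds M m.
        (\<forall>bs\<in>tuples (indiv M) m. D bs = S (as @ bs)) \<and> h as D"
  shows "is_model M (choice_h n m)"
proof -
  have "sat M v V (choice_form xs ys D S H)"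
    if asg: "assignment M v V" and xs: "length xs = n" "length ys = m" "distinct (xs @ ys)"
      and DS: "fst D = m" "fst S = n + m"
      and H: "free_ivars H \<subseteq> set xs" "free_pvars H \<subseteq> {D}" for v V xs ys D S H
  proof -
    define h where "h as P = sat M (upds v xs as) (V(D := P)) H" for as P
    have h: "h as P = sat M w W H" if "as \<in> tuples (indiv M) n" "W D = P"
      "\<forall>x\<in>set xs. w x = upds v xs as x" for as P w W
      unfolding h_def by (rule sat_cong) (use H that in auto)
    \<comment> \<open>The sort n + m of \<open>S\<close> exceeds the sort m of \<open>D\<close>, so
      assigning a value to \<open>D\<close> does not overwrite the one given to
      \<open>S\<close>.\<close>
    have ne: "S \<noteq> D" using DS \<open>n \<ge> 1\<close> by auto
    have "\<exists>Q\<in>preds M (n + m). \<forall>as\<in>tuples (indiv M) n. \<exists>P\<in>preds M m.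
        (\<forall>bs\<in>tuples (indiv M) m. P bs = Q (as @ bs)) \<and> h as P"
      if "sat M v V (AllIs xs (ExP D H))"
    proof (rule choice)
      show "\<exists>P\<in>preds M m. h as P" if "as \<in> tuples (indiv M) n" for as
        using \<open>sat M v V (AllIs xs (ExP D H))\<close> that by (auto simp: sat_AllIs xs DS h_def)
      have "\<forall>v V as P. as \<in> tuples (indiv M) n \<longrightarrow> h as P = sat M (upds v xs as) (V(D := P)) H"
      proof (intro allI impI)
        fix w W as P assume "as \<in> tuples (indiv M) n"
        then show "h as P = sat M (upds w xs as) (W(D := P)) H"
          by (intro h) (use xs in \<open>auto simp: tuples_def intro!: upds_eq\<close>)
      qed
      then show "\<exists>xs D H. length xs = n \<and> distinct xs \<and> free_ivars H \<subseteq> set xs \<and> free_pvars H \<subseteq> {D} \<and>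
        (\<forall>v V as P. as \<in> tuples (indiv M) n \<longrightarrow> h as P = sat M (upds v xs as) (V(D := P)) H)"
        using xs H by (intro exI[of _ xs] exI[of _ D] exI[of _ H]) auto
    qed
    moreover have "sat M v V (ExP S (AllIs xs (ExP D
            (Conj (AllIs ys (Iff (App D ys) (App S (xs @ ys)))) H))))"
      if Q: "Q \<in> preds M (n + m)" "\<forall>as\<in>tuples (indiv M) n. \<exists>P\<in>preds M m.
        (\<forall>bs\<in>tuples (indiv M) m. P bs = Q (as @ bs)) \<and> h as P" for Q
    proof -
      have "sat M (upds v xs as) (V(S := Q)) (ExP D
            (Conj (AllIs ys (Iff (App D ys) (App S (xs @ ys)))) H))"
        if as: "as \<in> tuples (indiv M) n" for as
      proof -
        obtain P where P: "P \<in> preds M m" "\<forall>bs\<in>tuples (indiv M) m. P bs = Q (as @ bs)" "h as P"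
          using Q(2) as by blast
        have "map (upds (upds v xs as) ys bs) (xs @ ys) = as @ bs"
          if "bs \<in> tuples (indiv M) m" for bs
        proof -
          have "map (upds (upds v xs as) ys bs) xs = map (upds v xs as) xs"
            using xs by (auto intro!: upds_notin)
          also have "\<dots> = as" using as xs by (intro map_upds) (auto simp: tuples_def)
          finally show ?thesis using that xs by (auto simp: map_upds tuples_def)
        qed
        moreover have "map (upds (upds v xs as) ys bs) ys = bs"
          if "bs \<in> tuples (indiv M) m" for bs
          using that xs by (intro map_upds) (auto simp: tuples_def)
        moreover have "sat M (upds v xs as) (V(S := Q, D := P)) H"
          using P(3) h[OF as, of "V(S := Q, D := P)" P "upds v xs as"] by simp
        ultimately show ?thesis
          using P DS ne xs by (auto simp: sat_AllIs simp del: map_append intro!: bexI[of _ P])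
      qed
      then show ?thesis unfolding sat.simps(12) sat_AllIs xs DS using Q(1) by blast
    qed
    ultimately show ?thesis by (auto simp: choice_form_def simp del: sat.simps(12))
  qed
  then show ?thesis by (auto simp: is_model_def choice_h_def holds_def)
qed

section \<open>A model of the well-ordering principle\<close>

definition full_structure :: "'i set \<Rightarrow> 'i pstruct" where
  "full_structure X = \<lparr>indiv = X, preds = \<lambda>n. {P. \<forall>as. P as \<longrightarrow> as \<in> tuples X n}\<rparr>"

lemma indiv_full [simp]: "indiv (full_structure X) = X"
  by (simp add: full_structure_def)

lemma henkin_full: "X \<noteq> {} \<Longrightarrow> henkin_structure (full_structure X)"
  by (rule henkin_structureI) (auto simp: full_structure_def predicate_structure_def)

lemma choice_full:
  assumes "n \<ge> 1" "m \<ge> 1"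
  shows "is_model (full_structure X) (choice_h n m)"
  using assms
proof (rule choice_modelI)
  fix h
  assume "\<And>as. as \<in> tuples (indiv (full_structure X)) n \<Longrightarrow>
    \<exists>D\<in>preds (full_structure X) m. h as D"
  then obtain d where d: "\<And>as. as \<in> tuples X n \<Longrightarrow> d as \<in> preds (full_structure X) m \<and> h as (d as)"
    by (simp add: full_structure_def) metis
  \<comment> \<open>Choice in the metatheory has picked a witness \<open>d as\<close> for each
    tuple; all of them are glued into one relation by cutting a tuple after its first n
    entries.\<close>
  let ?S = "\<lambda>cs. cs \<in> tuples X (n + m) \<and> d (take n cs) (drop n cs)"
  have S: "?S \<in> preds (full_structure X) (n + m)"
    by (simp add: full_structure_def)
  have "d as \<in> preds (full_structure X) m \<and>
      (\<forall>bs\<in>tuples X m. d as bs = ?S (as @ bs)) \<and> h as (d as)" if "as \<in> tuples X n" for as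
    using d[OF that] that by (auto simp: tuples_def)
  then have "\<forall>as\<in>tuples X n. \<exists>D\<in>preds (full_structure X) m.
      (\<forall>bs\<in>tuples X m. D bs = ?S (as @ bs)) \<and> h as D"
    by blast
  then show "\<exists>S\<in>preds (full_structure X) (n + m). \<forall>as\<in>tuples (indiv (full_structure X)) n.
      \<exists>D\<in>preds (full_structure X) m.
        (\<forall>bs\<in>tuples (indiv (full_structure X)) m. D bs = S (as @ bs)) \<and> h as D"
    unfolding indiv_full by (rule bexI[OF _ S])
qed

lemma WO1_singleton: "holds (full_structure {a}) WO1"
proof -
  let ?M = "full_structure {a}"
  \<comment> \<open>The equality relation on one point orders both possible values of
    \<open>A\<close>, the empty set and the whole domain.\<close>
  let ?T = "\<lambda>as. as = [a, a]"
  have T: "?T \<in> preds ?M 2" by (simp add: full_structure_def tuples_def)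
  have "sat ?M v V WO1" for v V
    unfolding WO1_def Let_def sat.simps fst_conv
    by (intro ballI bexI[OF _ T]) (auto simp: lin_ord_def)
  then show ?thesis by (simp add: holds_def)
qed

section \<open>Permutations and supports\<close>

text \<open>As A and \<open>f\<close> A\<open>have the same finite size, so do\<close>f
  \<open>A - A\<close> and \<open>A - f\<close>
  A\<open>. A bijection from the former to the latter closes\<close>f\<open>up to a permutation of\<close>A
  \<union> f \<open>A\<close>, and the identity is taken elsewhere.\<close>

lemma finite_inj_extend:
  fixes f :: "'a \<Rightarrow> 'a"
  assumes "finite A" "inj_on f A"
  obtains p where "bij p" "\<And>x. x \<in> A \<Longrightarrow> p x = f x"
proof -
  have "card (f ` A - A) = card (A - f ` A)"
  proof -
    have "card (f ` A - A) = card (f ` A) - card (f ` A \<inter> A)"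
      using assms by (simp add: card_Diff_subset_Int)
    also have "\<dots> = card (A - f ` A)"
      using assms by (simp add: card_Diff_subset_Int card_image Int_commute)
    finally show ?thesis .
  qed
  then obtain g where g: "bij_betw g (f ` A - A) (A - f ` A)"
    using assms by (metis finite_Diff finite_imageI finite_same_card_bij)
  define p where "p x = (if x \<in> A then f x else if x \<in> f ` A then g x else x)" for x
  have "bij_betw p A (f ` A)" using assms by (simp add: p_def bij_betw_def inj_on_def)
  moreover have "bij_betw p (f ` A - A) (A - f ` A)"
    using g by (rule bij_betw_cong[THEN iffD1, rotated]) (simp add: p_def)
  moreover have "bij_betw p (- (A \<union> f ` A)) (- (A \<union> f ` A))"
    by (rule bij_betw_cong[THEN iffD1, OF _ bij_betw_id]) (simp add: p_def)
  ultimately have "bij_betw p (A \<union> (f ` A - A) \<union> - (A \<union> f ` A)) (f ` A \<union> (A - f ` A) \<union> - (A \<union> f ` A))"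
    by (intro bij_betw_combine) auto
  moreover have "A \<union> (f ` A - A) \<union> - (A \<union> f ` A) = UNIV" "f ` A \<union> (A - f ` A) \<union> - (A \<union> f ` A) = UNIV"
    by auto
  ultimately have "bij p" by (simp only:)
  then show ?thesis using that[of p] by (simp add: p_def)
qed

text \<open>The image of a relation under \<open>p\<close>: the inverse appears because
  \<open>act p P\<close> is to hold at \<open>map p as\<close> exactly when \<open>P\<close> holds
  at \<open>as\<close>.\<close>

definition act :: "('i \<Rightarrow> 'i) \<Rightarrow> ('i list \<Rightarrow> bool) \<Rightarrow> 'i list \<Rightarrow> bool" where
  "act p P as = P (map (inv p) as)"

text \<open>Invariance under the pointwise stabilizer of \<open>E\<close>, the usual notion of
  support in permutation models.\<close>

definition supports :: "'i set \<Rightarrow> ('i list \<Rightarrow> bool) \<Rightarrow> bool" where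
  "supports E P \<longleftrightarrow> (\<forall>p. bij p \<longrightarrow> (\<forall>e\<in>E. p e = e) \<longrightarrow> (\<forall>as. P (map p as) = P as))"

lemma map_inv_map: "bij p \<Longrightarrow> map (inv p) (map p as) = as"
  by (simp add: bij_is_inj o_def)

lemma map_map_inv: "bij p \<Longrightarrow> map p (map (inv p) as) = as"
  by (simp add: bij_is_surj o_def surj_f_inv_f)

lemma act_act_inv: "bij p \<Longrightarrow> act p (act (inv p) P) = P"
  by (simp add: act_def fun_eq_iff inv_inv_eq map_map_inv del: map_map)

lemma act_inj: "bij p \<Longrightarrow> act p P = act p Q \<longleftrightarrow> P = Q"
  unfolding act_def fun_eq_iff by (metis map_inv_map)

lemma supports_act:
  assumes p: "bij p" and "supports E P"
  shows "supports (p ` E) (act p P)"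
  unfolding supports_def
proof (intro allI impI)
  fix q as assume q: "bij q" "\<forall>e\<in>p ` E. q e = e"
  have "bij (inv p \<circ> q \<circ> p)" using p q by (simp add: bij_comp bij_imp_bij_inv)
  moreover have "\<forall>e\<in>E. (inv p \<circ> q \<circ> p) e = e" using q p by (simp add: bij_is_inj)
  ultimately have "P (map (inv p \<circ> q \<circ> p) (map (inv p) as)) = P (map (inv p) as)"
    using \<open>supports E P\<close> unfolding supports_def by blast
  moreover have "inv p \<circ> q \<circ> p \<circ> inv p = inv p \<circ> q"
    using p by (simp add: fun_eq_iff bij_is_surj surj_f_inv_f)
  ultimately show "act p P (map q as) = act p P as" by (simp add: act_def)
qed

lemma act_supported:
  assumes "supports E P" "bij p" "\<forall>e\<in>E. p e = e"
  shows "act p P = P"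
proof -
  have "\<forall>e\<in>E. inv p e = e" using assms by (metis bij_inv_eq_iff)
  then show ?thesis using assms by (auto simp: act_def supports_def fun_eq_iff bij_imp_bij_inv)
qed

lemma supports_mono: "supports E P \<Longrightarrow> E \<subseteq> F \<Longrightarrow> supports F P"
  unfolding supports_def by blast

section \<open>Fraenkel's basic model\<close>

definition fraenkel :: "'i pstruct" where
  "fraenkel = \<lparr>indiv = UNIV,
     preds = \<lambda>n. {P. (\<forall>as. P as \<longrightarrow> length as = n) \<and> (\<exists>E. finite E \<and> supports E P)}\<rparr>"

lemma indiv_fraenkel [simp]: "indiv fraenkel = UNIV"
  by (simp add: fraenkel_def)

lemma preds_fraenkel:
  "P \<in> preds fraenkel n \<longleftrightarrow> (\<forall>as. P as \<longrightarrow> length as = n) \<and> (\<exists>E. finite E \<and> supports E P)"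
  by (simp add: fraenkel_def)

lemma tuples_UNIV [simp]: "as \<in> tuples UNIV n \<longleftrightarrow> length as = n"
  by (simp add: tuples_def)

lemma act_preds:
  assumes "bij p" "P \<in> preds fraenkel n"
  shows "act p P \<in> preds fraenkel n"
proof -
  obtain E where "finite E" "supports E P" using assms by (auto simp: preds_fraenkel)
  then have "\<exists>E. finite E \<and> supports E (act p P)"
    using supports_act[OF assms(1)] by (intro exI[of _ "p ` E"]) auto
  then show ?thesis using assms by (fastforce simp: preds_fraenkel act_def)
qed

lemma act_image_preds:
  assumes "bij p"
  shows "act p ` preds fraenkel n = preds fraenkel n"
proof -
  have "P \<in> act p ` preds fraenkel n" if "P \<in> preds fraenkel n" for P
    using act_preds[OF bij_imp_bij_inv[OF assms] that] act_act_inv[OF assms] by (metis image_eqI)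
  then show ?thesis using act_preds[OF assms] by blast
qed

text \<open>Every permutation of the individuals induces an automorphism of the model. Equalities
  are preserved by injectivity; individual quantifiers are reindexed along \<open>p\<close>, and
  predicate quantifiers along \<open>act p\<close>, which permutes each sort by
  \<open>act_image_preds\<close>.\<close>

lemma sat_act:
  assumes p: "bij p"
  shows "sat fraenkel (p \<circ> v) (\<lambda>A. act p (V A)) F = sat fraenkel v V F"
proof (induction F arbitrary: v V)
  case (EqI x y)
  then show ?case using p by (simp add: bij_is_inj inj_eq)
next
  case (EqP A B)
  then show ?case using p by (simp add: act_inj)
next
  case (App A xs)
  show ?case using map_inv_map[OF p, of "map v xs"] unfolding act_def sat.simps by (metis map_map)
next
  case (AllI x F)
  have "(\<forall>b. sat fraenkel ((p \<circ> v)(x := b)) (\<lambda>A. act p (V A)) F) \<longleftrightarrow>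
      (\<forall>a. sat fraenkel ((p \<circ> v)(x := p a)) (\<lambda>A. act p (V A)) F)"
    using p by (metis bij_pointE)
  also have "\<dots> \<longleftrightarrow> (\<forall>a. sat fraenkel (v(x := a)) V F)"
    by (simp only: fun_upd_comp[symmetric] AllI.IH)
  finally show ?case by (simp only: sat.simps indiv_fraenkel ball_UNIV bex_UNIV)
next
  case (ExI x F)
  have "(\<exists>b. sat fraenkel ((p \<circ> v)(x := b)) (\<lambda>A. act p (V A)) F) \<longleftrightarrow>
      (\<exists>a. sat fraenkel ((p \<circ> v)(x := p a)) (\<lambda>A. act p (V A)) F)"
    using p by (metis bij_pointE)
  also have "\<dots> \<longleftrightarrow> (\<exists>a. sat fraenkel (v(x := a)) V F)"
    by (simp only: fun_upd_comp[symmetric] ExI.IH)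
  finally show ?case by (simp only: sat.simps indiv_fraenkel ball_UNIV bex_UNIV)
next
  case (AllP A F)
  have "(\<lambda>B. act p (V B))(A := act p P) = (\<lambda>B. act p ((V(A := P)) B))" for P
    by auto
  then have "sat fraenkel (p \<circ> v) ((\<lambda>B. act p (V B))(A := act p P)) F = sat fraenkel v (V(A := P)) F" for P
    using AllP.IH by presburger
  then have "(\<forall>Q\<in>act p ` preds fraenkel (fst A). sat fraenkel (p \<circ> v) ((\<lambda>B. act p (V B))(A := Q)) F) =
    (\<forall>P\<in>preds fraenkel (fst A). sat fraenkel v (V(A := P)) F)"
    by simp
  then show ?case by (simp only: sat.simps act_image_preds[OF p])
next
  case (ExP A F)
  have "(\<lambda>B. act p (V B))(A := act p P) = (\<lambda>B. act p ((V(A := P)) B))" for P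
    by auto
  then have "sat fraenkel (p \<circ> v) ((\<lambda>B. act p (V B))(A := act p P)) F = sat fraenkel v (V(A := P)) F" for P
    using ExP.IH by presburger
  then have "(\<exists>Q\<in>act p ` preds fraenkel (fst A). sat fraenkel (p \<circ> v) ((\<lambda>B. act p (V B))(A := Q)) F) =
    (\<exists>P\<in>preds fraenkel (fst A). sat fraenkel v (V(A := P)) F)"
    by simp
  then show ?case by (simp only: sat.simps act_image_preds[OF p])
qed simp_all

lemma preds_fraenkel_nonempty: "preds fraenkel n \<noteq> {}"
proof -
  have "(\<lambda>_. False) \<in> preds fraenkel n"
    by (auto simp: preds_fraenkel supports_def)
  then show ?thesis by blast
qed

lemma henkin_fraenkel: "henkin_structure (fraenkel :: 'i pstruct)"
proof (rule henkin_structureI)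
  show "predicate_structure (fraenkel :: 'i pstruct)"
    using preds_fraenkel_nonempty by (auto simp: predicate_structure_def preds_fraenkel)
next
  fix v :: "ivar \<Rightarrow> 'i" and V xs H
  assume asg: "assignment fraenkel v V" and "wff H"
  have "\<forall>A\<in>free_pvars H. \<exists>E. finite E \<and> supports E (V A)"
    using asg wff_free_pvars[OF \<open>wff H\<close>] by (auto simp: assignment_def preds_fraenkel)
  then obtain E where E: "\<And>A. A \<in> free_pvars H \<Longrightarrow> finite (E A) \<and> supports (E A) (V A)" by metis
  \<comment> \<open>A definable predicate is supported by its parameters: the values of the free
    individual variables and supports of the free predicate variables. A permutation fixing these
    moves only the argument tuple, so \<open>sat_act\<close> gives the invariance.\<close>
  let ?E = "v ` free_ivars H \<union> (\<Union>A\<in>free_pvars H. E A)"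
  let ?Q = "\<lambda>as. length as = length xs \<and> sat fraenkel (upds v xs as) V H"
  have "supports ?E ?Q"
    unfolding supports_def
  proof (intro allI impI)
    fix p as assume p: "bij p" "\<forall>e\<in>?E. p e = e"
    have "sat fraenkel (upds v xs (map p as)) V H = sat fraenkel (upds v xs as) V H"
      if len: "length as = length xs"
    proof -
      have "sat fraenkel (upds v xs (map p as)) V H =
          sat fraenkel (p \<circ> upds v xs as) (\<lambda>A. act p (V A)) H"
      proof (rule sat_cong)
        show "\<forall>x\<in>free_ivars H. upds v xs (map p as) x = (p \<circ> upds v xs as) x"
          unfolding comp_upds[OF len] using p(2) by (auto intro!: upds_cong)
        show "\<forall>A\<in>free_pvars H. V A = act p (V A)"
        proof
          fix A assume A: "A \<in> free_pvars H"
          then have "\<forall>e\<in>E A. p e = e" using p(2) by blast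
          then show "V A = act p (V A)" using act_supported[of "E A" "V A" p] E[OF A] p(1) by simp
        qed
      qed
      also have "\<dots> = sat fraenkel (upds v xs as) V H" by (rule sat_act[OF p(1)])
      finally show ?thesis .
    qed
    then show "?Q (map p as) = ?Q as" by auto
  qed
  moreover have "finite ?E" using E finite_free_ivars finite_free_pvars by auto
  ultimately have "\<exists>E. finite E \<and> supports E ?Q" by blast
  then show "(\<lambda>as. as \<in> tuples (indiv fraenkel) (length xs) \<and> sat fraenkel (upds v xs as) V H)
      \<in> preds fraenkel (length xs)"
    by (simp add: preds_fraenkel)
qed

lemma not_WO1_fraenkel:
  assumes "infinite (UNIV :: 'i set)"
  shows "holds (fraenkel :: 'i pstruct) (Neg WO1)"
proof -
  let ?A = "\<lambda>as :: 'i list. length as = 1"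
  have A: "?A \<in> preds fraenkel 1"
    by (auto simp: preds_fraenkel supports_def)
  have False if T: "T \<in> preds fraenkel 2"
    and anti: "\<forall>a b. T [a, b] \<and> T [b, a] \<longrightarrow> a = b" and tot: "\<forall>a b. T [a, b] \<or> T [b, a]"
  for T :: "'i list \<Rightarrow> bool"
  proof -
    obtain E where E: "finite E" "supports E T" using T by (auto simp: preds_fraenkel)
    obtain a where a: "a \<notin> E" using ex_new_if_finite[OF assms E(1)] by blast
    obtain b where b: "b \<notin> insert a E" using ex_new_if_finite[OF assms, of "insert a E"] E(1) by blast
    \<comment> \<open>The transposition of two points outside the support makes T[a, b] and T[b, a]
      equivalent; totality then yields both, and antisymmetry forces a = b.\<close>
    let ?p = "id(a := b, b := a)"
    have "bij ?p" by (rule involuntory_imp_bij) (auto)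
    moreover have "\<forall>e\<in>E. ?p e = e" using a b by auto
    ultimately have "T (map ?p [a, b]) = T [a, b]"
      using E(2)[unfolded supports_def, rule_format, of ?p "[a, b]"] by blast
    then have "T [b, a] = T [a, b]" using b by auto
    then show False using anti tot b by blast
  qed
  note no_order = this
  have "\<not> sat fraenkel v V WO1" for v :: "ivar \<Rightarrow> 'i" and V
  proof
    assume "sat fraenkel v V WO1"
    then obtain T where T: "T \<in> preds fraenkel 2"
      and "sat fraenkel v (V((1, 0) := ?A, (2, 0) := T)) (lin_ord (1, 0) (2, 0))"
      using A unfolding WO1_def Let_def sat.simps fst_conv by blast
    \<comment> \<open>Dropping reflexivity leaves antisymmetry, transitivity and totality; the first
      and the last of these are extracted below.\<close>
    note lin = this(2)[unfolded lin_ord_def sat.simps(5), THEN conjunct2]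
    have "\<forall>a b. T [a, b] \<and> T [b, a] \<longrightarrow> a = b"
      using lin[THEN conjunct1] by simp
    moreover have "\<forall>a b. T [a, b] \<or> T [b, a]"
      using lin[THEN conjunct2, THEN conjunct2] by simp
    ultimately show False by (rule no_order[OF T])
  qed
  then show ?thesis by (simp add: holds_def)
qed

section \<open>Choice in Fraenkel's model\<close>

text \<open>The combinatorial core of choice, freed from syntax: a formula without parameters enters
  only through the equivariance of \<open>h\<close>.\<close>

lemma equivariant_uniformization:
  fixes h :: "'i list \<Rightarrow> ('i list \<Rightarrow> bool) \<Rightarrow> bool"
  assumes inf: "infinite (UNIV :: 'i set)"
    and ex: "\<And>as. length as = n \<Longrightarrow> \<exists>D\<in>preds fraenkel m. h as D"
    and equiv: "\<And>p as D. bij p \<Longrightarrow> length as = n \<Longrightarrow> h as D \<Longrightarrow> h (map p as) (act p D)"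
  shows "\<exists>S\<in>preds fraenkel (n + m). \<forall>as. length as = n \<longrightarrow>
    (\<exists>D\<in>preds fraenkel m. (\<forall>bs. length bs = m \<longrightarrow> D bs = S (as @ bs)) \<and> h as D)"
proof -
  \<comment> \<open>An n-tuple has at most n distinct entries, so some permutation moves it into
    \<open>X\<close>. Hence the finite set \<open>C\<close> of n-tuples over \<open>X\<close> meets
    every orbit.\<close>
  obtain X :: "'i set" where X: "finite X" "card X = n"
    using infinite_arbitrarily_large[OF inf] by blast
  obtain d where d: "\<And>as. length as = n \<Longrightarrow> d as \<in> preds fraenkel m \<and> h as (d as)"
    using ex by metis
  then have "\<forall>as. length as = n \<longrightarrow> (\<exists>E. finite E \<and> supports E (d as))"
    by (simp add: preds_fraenkel)
  then obtain e where e: "\<And>as. length as = n \<Longrightarrow> finite (e as) \<and> supports (e as) (d as)" by metis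
  define C where "C = {c. set c \<subseteq> X \<and> length c = n}"
  have "finite C" unfolding C_def using finite_lists_length_eq[OF X(1)] .
  define E where "E = (\<Union>c\<in>C. e c)"
  have finE: "finite E" using \<open>finite C\<close> e by (auto simp: E_def C_def)
  have supE: "supports E (d c)" if "c \<in> C" for c
    using e[of c] that by (auto simp: C_def E_def intro: supports_mono)
  \<comment> \<open>Removing the at most n entries of a tuple from \<open>P\<close> leaves at least
    \<open>card E\<close> points, room for an injective copy of any part of
    \<open>E\<close>.\<close>
  obtain P :: "'i set" where P: "finite P" "card P = n + card E"
    using infinite_arbitrarily_large[OF inf] by blast

  \<comment> \<open>The predicate under \<open>SOME\<close> depends only on the orbit of
    \<open>as\<close>, so the same representative is chosen throughout an orbit; this is
    \<open>c_eq\<close>.\<close>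
  define c where "c as = (SOME c. c \<in> C \<and> (\<exists>p. bij p \<and> map p c = as))" for as :: "'i list"
  have c: "c as \<in> C \<and> (\<exists>p. bij p \<and> map p (c as) = as)" if len: "length as = n" for as
    unfolding c_def
  proof (rule someI_ex)
    have "card (set as) \<le> card X" using card_length[of as] len X by simp
    then obtain f where f: "f ` set as \<subseteq> X" "inj_on f (set as)"
      using X(1) by (metis List.finite_set card_le_inj)
    obtain p where p: "bij p" "\<And>x. x \<in> set as \<Longrightarrow> p x = f x"
      using finite_inj_extend[OF _ f(2)] by auto
    have "map p as \<in> C" using p f len by (auto simp: C_def)
    moreover have "map (inv p) (map p as) = as" using p(1) by (rule map_inv_map)
    ultimately show "\<exists>c. c \<in> C \<and> (\<exists>p. bij p \<and> map p c = as)"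
      using bij_imp_bij_inv[OF p(1)] by blast
  qed
  have c_eq: "c (map s as) = c as" if s: "bij s" for s as
  proof -
    have "(\<exists>p. bij p \<and> map p c = map s as) \<longleftrightarrow> (\<exists>p. bij p \<and> map p c = as)" for c :: "'i list"
    proof
      assume "\<exists>p. bij p \<and> map p c = map s as"
      then obtain p where "bij p" "map p c = map s as" by blast
      then have "map (inv s \<circ> p) c = as" using map_inv_map[OF s, of as] by (metis map_map)
      then show "\<exists>p. bij p \<and> map p c = as"
        using \<open>bij p\<close> bij_imp_bij_inv[OF s] bij_comp by blast
    next
      assume "\<exists>p. bij p \<and> map p c = as"
      then obtain p where "bij p" "map p c = as" by blast
      then have "map (s \<circ> p) c = map s as" by auto
      then show "\<exists>p. bij p \<and> map p c = map s as" using \<open>bij p\<close> s bij_comp by blast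
    qed
    then show ?thesis by (simp only: c_def)
  qed

  \<comment> \<open>The injection is chosen from the two sets alone. A permutation fixing
    \<open>P\<close> pointwise does not change \<open>P - set as\<close>, hence does not change the
    injection.\<close>
  define r where "r Y Z = (SOME f :: 'i \<Rightarrow> 'i. f ` Y \<subseteq> Z \<and> inj_on f Y)" for Y Z
  have r: "r (E - set b) (P - set as) ` (E - set b) \<subseteq> P - set as \<and>
      inj_on (r (E - set b) (P - set as)) (E - set b)" if len: "length as = n" for b as
  proof -
    have "card (E - set b) \<le> card E" using finE by (simp add: card_mono)
    also have "\<dots> \<le> card P - card (set as)" using P card_length[of as] len by simp
    also have "\<dots> \<le> card (P - set as)" by (simp add: diff_card_le_card_Diff)
    finally have "\<exists>f. f ` (E - set b) \<subseteq> P - set as \<and> inj_on f (E - set b)"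
      using finE P(1) by (meson card_le_inj finite_Diff)
    then show ?thesis unfolding r_def by (rule someI_ex)
  qed
  have "\<exists>q. bij q \<and> map q (c as) = as \<and>
      (\<forall>x\<in>E - set (c as). q x = r (E - set (c as)) (P - set as) x)" if len: "length as = n" for as
  proof -
    let ?r = "r (E - set (c as)) (P - set as)"
    obtain p where p: "bij p" "map p (c as) = as" using c[OF len] by blast
    have pim: "p ` set (c as) = set as" using p(2) by (metis list.set_map)
    \<comment> \<open>The entries of the representative go to the entries of \<open>as\<close>, and
      the rest of \<open>E\<close> goes into \<open>P\<close> away from them. The two images are
      disjoint, so the map is injective and extends to a permutation.\<close>
    let ?f = "\<lambda>x. if x \<in> set (c as) then p x else ?r x"
    have "inj_on ?f (set (c as) \<union> (E - set (c as)))"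
      unfolding inj_on_Un
    proof (intro conjI)
      show "inj_on ?f (set (c as))" using p(1) by (auto simp: inj_on_def bij_def)
      show "inj_on ?f (E - set (c as))" using r[OF len, of "c as"] by (auto simp: inj_on_def)
      show "?f ` (set (c as) - (E - set (c as))) \<inter> ?f ` (E - set (c as) - set (c as)) = {}"
        using r[OF len, of "c as"] pim by auto
    qed
    then obtain q where q: "bij q" "\<And>x. x \<in> set (c as) \<union> (E - set (c as)) \<Longrightarrow> q x = ?f x"
      using finite_inj_extend[of "set (c as) \<union> (E - set (c as))" ?f] finE by auto
    have "map q (c as) = map p (c as)" using q(2) by simp
    then show ?thesis using q p by (intro exI[of _ q]) auto
  qed
  then obtain q where q: "\<And>as. length as = n \<Longrightarrow> bij (q as) \<and> map (q as) (c as) = as \<and>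
      (\<forall>x\<in>E - set (c as). q as x = r (E - set (c as)) (P - set as) x)"
    by metis

  \<comment> \<open>The witness for the representative is transported to \<open>as\<close>;
    equivariance of \<open>h\<close> makes it a witness for \<open>as\<close>.\<close>
  define D where "D as = act (q as) (d (c as))" for as
  have D: "D as \<in> preds fraenkel m \<and> h as (D as)" if len: "length as = n" for as
  proof -
    have len': "length (c as) = n" using c[OF len] by (simp add: C_def)
    show ?thesis using d[OF len'] q[OF len] equiv[of "q as" "c as"] len' act_preds
      unfolding D_def by metis
  qed
  have D_equiv: "D (map s as) (map s bs) = D as bs"
    if len: "length as = n" and s: "bij s" "\<forall>x\<in>P. s x = x" for s as bs
  proof -
    let ?q = "q as" and ?q' = "q (map s as)" and ?c = "c as"
    have len': "length (map s as) = n" using len by simp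
    note q1 = q[OF len] and q2 = q[OF len']
    have "P - set (map s as) = P - set as"
    proof -
      have "x \<in> s ` set as \<longleftrightarrow> x \<in> set as" if "x \<in> P" for x
        using s that by (metis bij_is_inj image_iff inj_eq)
      then show ?thesis by auto
    qed
    then have q2': "bij ?q'" "map ?q' ?c = map s as"
      "\<forall>x\<in>E - set ?c. ?q' x = r (E - set ?c) (P - set as) x"
      using q2 by (simp_all add: c_eq[OF s(1)])
    \<comment> \<open>On entries of the representative both sides are the corresponding entry of
      \<open>map s as\<close>. On the rest of \<open>E\<close> both are the same value of
      \<open>r\<close>, which lies in \<open>P\<close> and is therefore fixed by
      \<open>s\<close>.\<close>
    have agree: "?q' x = s (?q x)" if "x \<in> E" for x
    proof (cases "x \<in> set ?c")
      case True
      have "map ?q' ?c = map (s \<circ> ?q) ?c" using q2'(2) q1 by (metis map_map)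
      then show ?thesis using True by simp
    next
      case False
      then have "r (E - set ?c) (P - set as) x \<in> P" using r[OF len, of ?c] that by blast
      then show ?thesis using False that q1 q2'(3) s(2) by simp
    qed
    \<comment> \<open>By \<open>agree\<close> this permutation fixes \<open>E\<close> pointwise, so
      it preserves \<open>d ?c\<close>: transporting that witness by \<open>?q'\<close> gives the
      same relation as transporting it by \<open>?q\<close> and then by \<open>s\<close>.\<close>
    let ?t = "inv ?q' \<circ> s \<circ> ?q"
    have "bij ?t" using q1 q2'(1) s(1) by (simp add: bij_comp bij_imp_bij_inv)
    moreover have "\<forall>x\<in>E. ?t x = x" using agree q2'(1) by (metis bij_inv_eq_iff comp_apply)
    ultimately have "d ?c (map ?t (map (inv ?q) bs)) = d ?c (map (inv ?q) bs)"
      using supE c[OF len] unfolding supports_def by blast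
    moreover have "map ?t (map (inv ?q) bs) = map (inv ?q') (map s bs)"
      using q1 by (simp add: bij_is_surj surj_f_inv_f)
    ultimately show ?thesis by (simp only: D_def act_def c_eq[OF s(1)])
  qed

  let ?S = "\<lambda>cs. length cs = n + m \<and> D (take n cs) (drop n cs)"
  have "supports P ?S"
    using D_equiv by (auto simp: supports_def take_map drop_map)
  then have S: "?S \<in> preds fraenkel (n + m)" using P(1) by (auto simp: preds_fraenkel)
  have "D as \<in> preds fraenkel m \<and>
      (\<forall>bs. length bs = m \<longrightarrow> D as bs = ?S (as @ bs)) \<and> h as (D as)" if "length as = n" for as
    using D[OF that] that by simp
  then have "\<forall>as. length as = n \<longrightarrow> (\<exists>D\<in>preds fraenkel m.
      (\<forall>bs. length bs = m \<longrightarrow> D bs = ?S (as @ bs)) \<and> h as D)"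
    by blast
  then show ?thesis by (rule bexI[OF _ S])
qed

lemma choice_fraenkel:
  assumes inf: "infinite (UNIV :: 'i set)" and "n \<ge> 1" "m \<ge> 1"
  shows "is_model (fraenkel :: 'i pstruct) (choice_h n m)"
  using assms(2,3)
proof (rule choice_modelI)
  fix h :: "'i list \<Rightarrow> ('i list \<Rightarrow> bool) \<Rightarrow> bool"
  assume ex: "\<And>as. as \<in> tuples (indiv (fraenkel :: 'i pstruct)) n \<Longrightarrow> \<exists>D\<in>preds fraenkel m. h as D"
  assume "\<exists>xs D H. length xs = n \<and> distinct xs \<and> free_ivars H \<subseteq> set xs \<and> free_pvars H \<subseteq> {D} \<and>
    (\<forall>v V as P. as \<in> tuples (indiv (fraenkel :: 'i pstruct)) n \<longrightarrow>
      h as P = sat fraenkel (upds v xs as) (V(D := P)) H)"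
  then obtain xs D H where xs: "length xs = n"
    and h: "\<And>v V as P. length as = n \<Longrightarrow> h as P = sat fraenkel (upds v xs as) (V(D := P)) H"
    unfolding indiv_fraenkel tuples_UNIV by blast
  have equiv: "h (map p as) (act p P)" if p: "bij p" and len: "length as = n" and "h as P" for p as P
  proof -
    fix v :: "ivar \<Rightarrow> 'i" and V :: "pvar \<Rightarrow> 'i list \<Rightarrow> bool"
    have "sat fraenkel (upds v xs as) (V(D := P)) H"
      using h[OF len, of P v V] \<open>h as P\<close> by simp
    then have "sat fraenkel (p \<circ> upds v xs as) (\<lambda>A. act p ((V(D := P)) A)) H"
      using sat_act[OF p, of "upds v xs as" "V(D := P)" H] by blast
    moreover have "(\<lambda>A. act p ((V(D := P)) A)) = (\<lambda>A. act p (V A))(D := act p P)" by auto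
    \<comment> \<open>Because \<open>h\<close> describes truth of \<open>H\<close> under every
      assignment, it may be read here at the assignment moved by \<open>p\<close>.\<close>
    ultimately show ?thesis
      using h[of "map p as" "act p P" "p \<circ> v" "\<lambda>A. act p (V A)"] len xs
        comp_upds[of as xs p v] by (simp only: length_map)
  qed
  have "\<exists>D\<in>preds fraenkel m. h as D" if "length as = n" for as
    using ex[of as] that by simp
  note unif = equivariant_uniformization[OF inf this equiv]
  show "\<exists>S\<in>preds fraenkel (n + m). \<forall>as\<in>tuples (indiv (fraenkel :: 'i pstruct)) n.
    \<exists>D\<in>preds fraenkel m.
      (\<forall>bs\<in>tuples (indiv (fraenkel :: 'i pstruct)) m. D bs = S (as @ bs)) \<and> h as D"
    unfolding Ball_def[of "tuples _ _"] indiv_fraenkel tuples_UNIV by (rule unif)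
qed

section \<open>Independence\<close>

text \<open>The components of a Henkin structure are nonempty, so it admits an assignment; therefore
  a formula and its negation cannot both hold in it, even with truth read over all
  assignments.\<close>

lemma HPL_independentI:
  fixes M N :: "'i pstruct"
  assumes M: "henkin_structure M" "is_model M (\<Gamma> \<union> {F})"
    and N: "henkin_structure N" "is_model N (\<Gamma> \<union> {Neg F})"
  shows "HPL_independent TYPE('i) \<Gamma> F"
proof -
  have "\<exists>v V. assignment K v V" if "henkin_structure K" for K :: "'i pstruct"
  proof -
    have "indiv K \<noteq> {}" "\<And>k. k \<ge> 1 \<Longrightarrow> preds K k \<noteq> {}"
      using that by (auto simp: henkin_structure_def predicate_structure_def)
    then have "assignment K (\<lambda>_. SOME a. a \<in> indiv K) (\<lambda>A. SOME P. P \<in> preds K (fst A))"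
      by (auto simp: assignment_def some_in_eq)
    then show ?thesis by blast
  qed
  then have "\<not> holds M (Neg F)" "\<not> holds N F"
    using assms by (fastforce simp: is_model_def holds_def)+
  then show ?thesis using assms by (auto simp: HPL_independent_def is_model_def)
qed

theorem theorem4p1:
  fixes n m :: nat
  assumes "infinite (UNIV :: 'i set)"
    and "n \<ge> 1" and "m \<ge> 1"
  shows "HPL_independent TYPE('i) (choice_h n m) WO1 \<and>
    (\<exists>M :: 'i pstruct. henkin_structure M \<and> is_model M (choice_h n m \<union> {WO1})) \<and>
    (\<exists>M :: 'i pstruct. henkin_structure M \<and> is_model M (choice_h n m \<union> {Neg WO1}))"
proof -
  let ?M = "full_structure {undefined} :: 'i pstruct" and ?N = "fraenkel :: 'i pstruct"
  have "henkin_structure ?M" "is_model ?M (choice_h n m \<union> {WO1})"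
    using henkin_full[of "{undefined}"] choice_full[OF assms(2,3)] WO1_singleton by (auto simp: is_model_def)
  moreover have "henkin_structure ?N" "is_model ?N (choice_h n m \<union> {Neg WO1})"
    using henkin_fraenkel choice_fraenkel[OF assms] not_WO1_fraenkel[OF assms(1)]
    by (auto simp: is_model_def)
  ultimately show ?thesis using HPL_independentI by blast
qed

end
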